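(* Let $G$ be a graph with edge expansion $\alpha(G)$. Suppose that $G$ has minimum degree $h\ge 1$ and average degree at most $2h$. Then $$q^*(G)\le 1-\min\left\{\frac{\alpha(G)}{2h},\ \frac{3}{16}\right\}.$$
   Context: Graphs are finite multigraphs (loops and multiple edges allowed); a loop counts $2$ towards the degree of its vertex. For a graph $G=(V,E)$ and $S\subseteq V$: $\bar S=V\setminus S$; $e(G)=|E|$; $e(S)$ is the number of edges (including loops, with multiplicity) with all endpoints in $S$; $e(S,\bar S)$ is the number of edges with one endpoint in $S$ and the other in $\bar S$; $\mathrm{vol}(S)=\sum_{v\in S}\deg(v)$ and $\mathrm{vol}(G)=\mathrm{vol}(V)$. The edge expansion of $G$ is $\alpha(G)=\min_{S\subseteq V,\ 1\le|S|\le |V|/2} e(S,\bar S)/|S|$, with $\alpha(G)=\infty$ if $|V|/2<1$. For a graph with at least one edge and a partition $\mathcal A$ of $V$, the modularity score is $$q_{\mathcal A}(G)=\sum_{S\in\mathcal A}\left(\frac{e(S)}{e(G)}-\left(\frac{\mathrm{vol}(S)}{\mathrm{vol}(G)}\right)^2\right),$$ and the modularity of $G$ is $q^*(G)=\max_{\mathcal A}q_{\mathcal A}(G)$, the maximum being over all partitions $\mathcal A$ of $V$. *)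

theory Defs
  imports Complex_Main "HOL-Library.Uprod" "HOL-Library.Disjoint_Sets"
    "HOL-Library.Extended_Real"
begin

text \<open>
  Undirected multigraphs: edges are named objects, so parallel edges are distinct elements of
  \<open>edges G\<close>, and each edge carries an unordered pair of end vertices; a loop at \<open>v\<close> is an edge
  with \<open>ends G e = Upair v v\<close>.
\<close>

record ('v, 'e) multigraph =
  verts :: "'v set"
  edges :: "'e set"
  ends :: "'e \<Rightarrow> 'v uprod"

locale finite_multigraph =
  fixes G :: "('v, 'e) multigraph"
  assumes finite_verts: "finite (verts G)"
    and verts_nonempty: "verts G \<noteq> {}"
    and finite_edges: "finite (edges G)"
    and ends_in_verts: "\<And>e. e \<in> edges G \<Longrightarrow> set_uprod (ends G e) \<subseteq> verts G"

text \<open>The second summand makes every loop count twice.\<close>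

definition degree :: "('v, 'e) multigraph \<Rightarrow> 'v \<Rightarrow> nat" where
  "degree G v = card {e \<in> edges G. v \<in> set_uprod (ends G e)}
              + card {e \<in> edges G. ends G e = Upair v v}"

definition vol :: "('v, 'e) multigraph \<Rightarrow> 'v set \<Rightarrow> nat" where
  "vol G S = (\<Sum>v\<in>S. degree G v)"

definition edges_inside :: "('v, 'e) multigraph \<Rightarrow> 'v set \<Rightarrow> nat" where
  "edges_inside G S = card {e \<in> edges G. set_uprod (ends G e) \<subseteq> S}"

definition edges_between :: "('v, 'e) multigraph \<Rightarrow> 'v set \<Rightarrow> 'v set \<Rightarrow> nat" where
  "edges_between G S T = card {e \<in> edges G. \<exists>u\<in>S. \<exists>v\<in>T. ends G e = Upair u v}"

definition min_degree :: "('v, 'e) multigraph \<Rightarrow> nat" where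
  "min_degree G = Min (degree G ` verts G)"

definition avg_degree :: "('v, 'e) multigraph \<Rightarrow> real" where
  "avg_degree G = real (vol G (verts G)) / real (card (verts G))"

definition edge_expansion :: "('v, 'e) multigraph \<Rightarrow> ereal" where
  "edge_expansion G =
    (if real (card (verts G)) / 2 < 1 then \<infinity>
     else ereal (Min {real (edges_between G S (verts G - S)) / real (card S) | S.
            S \<subseteq> verts G \<and> 1 \<le> card S \<and> real (card S) \<le> real (card (verts G)) / 2}))"

definition modularity_score :: "('v, 'e) multigraph \<Rightarrow> 'v set set \<Rightarrow> real" where
  "modularity_score G \<A> =
    (\<Sum>S\<in>\<A>. real (edges_inside G S) / real (card (edges G))
            - (real (vol G S) / real (vol G (verts G)))\<^sup>2)"

text \<open>Only meaningful for graphs with at least one edge (the score divides by the number of edges).\<close>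

definition modularity :: "('v, 'e) multigraph \<Rightarrow> real" where
  "modularity G = Max {modularity_score G \<A> | \<A>. partition_on (verts G) \<A>}"

end

theory Submission
  imports Defs
begin

text \<open>
  Write \<open>m\<close> and \<open>n\<close> for the numbers of edges and vertices and \<open>cut(S)\<close> for the number of edges
  leaving \<open>S\<close>. Since \<open>vol(S) = 2 e(S) + cut(S)\<close> (lemma \<open>vol_eq_inside_plus_between\<close>), the volumes
  of the parts of a partition add up to \<open>2m\<close>, and so the deficit of the score is a sum of
  nonnegative terms (lemma \<open>one_minus_modularity_score\<close>):
  \<open>1 - q = (\<Sum>S. cut(S) / 2m + (vol(S) / 2m)\<^sup>2)\<close>.

  Let \<open>b \<le> 1/4\<close> be such that \<open>cut(S) \<ge> 2hb |S|\<close> for every nonempty \<open>S\<close> with at most \<open>n/2\<close>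
  vertices. The bound on the average degree says that \<open>m \<le> hn\<close>. If no part has more than \<open>n/2\<close>
  vertices, then the cut terms alone contribute at least \<open>2hbn / 2m \<ge> b\<close>. Otherwise exactly one
  part \<open>B\<close> has more than half of the vertices, say \<open>xn\<close> of them. Its cut is also the cut of its
  complement, which is small, so the cuts of \<open>B\<close> and of the remaining parts contribute at least
  \<open>4hb(1 - x)n / 2m \<ge> 2b(1 - x)\<close>, while \<open>vol(B) \<ge> hxn\<close> makes the square at least \<open>x\<^sup>2/4\<close>.
  Completing the square,
  \<open>2b(1 - x) + x\<^sup>2/4 = b + (x/2 - 2b)\<^sup>2 + b(1 - 4b) \<ge> b\<close>.

  The theorem is the case where \<open>b\<close> is the minimum of \<open>\<alpha>(G)/2h\<close> and \<open>3/16\<close>.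
\<close>

section \<open>Volumes and cuts\<close>

text \<open>
  Double counting of pairs of an edge and an end of it in \<open>S\<close>: an edge inside \<open>S\<close> has two such ends
  (this is where loops have to count twice), an edge leaving \<open>S\<close> has one.
\<close>

lemma (in finite_multigraph) vol_eq_inside_plus_between:
  assumes "S \<subseteq> verts G"
  shows "vol G S = 2 * edges_inside G S + edges_between G S (verts G - S)"
proof -
  have finS: "finite S"
    using assms finite_verts finite_subset by blast
  have card_as_sum: "card {e \<in> edges G. P e} = (\<Sum>e\<in>edges G. of_bool (P e))" for P
    using finite_edges by (simp add: Int_def)
  have ends_count:
    "(\<Sum>v\<in>S. of_bool (v \<in> set_uprod (ends G e)) + of_bool (ends G e = Upair v v))
      = 2 * of_bool (set_uprod (ends G e) \<subseteq> S)
        + (of_bool (\<exists>u\<in>S. \<exists>v\<in>verts G - S. ends G e = Upair u v) :: nat)"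
    if e: "e \<in> edges G" for e
  proof -
    obtain a b where ab: "ends G e = Upair a b"
      by (cases "ends G e") auto
    have inV: "a \<in> verts G" "b \<in> verts G"
      using ends_in_verts[OF e] ab by auto
    have "(\<Sum>v\<in>S. of_bool (v \<in> set_uprod (ends G e)) + of_bool (ends G e = Upair v v))
        = (\<Sum>v\<in>S. of_bool (v = a) + (of_bool (v = b) :: nat))"
      by (rule sum.cong) (auto simp: ab)
    also have "\<dots> = of_bool (a \<in> S) + of_bool (b \<in> S)"
      using finS by (simp add: sum.distrib of_bool_def)
    also have "\<dots> = 2 * of_bool (set_uprod (ends G e) \<subseteq> S)
        + of_bool (\<exists>u\<in>S. \<exists>v\<in>verts G - S. ends G e = Upair u v)"
      using inV by (auto simp: ab)
    finally show ?thesis .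
  qed
  have "vol G S = (\<Sum>v\<in>S. \<Sum>e\<in>edges G.
      of_bool (v \<in> set_uprod (ends G e)) + of_bool (ends G e = Upair v v))"
    unfolding vol_def degree_def card_as_sum sum.distrib ..
  also have "\<dots> = (\<Sum>e\<in>edges G. \<Sum>v\<in>S.
      of_bool (v \<in> set_uprod (ends G e)) + of_bool (ends G e = Upair v v))"
    by (rule sum.swap)
  also have "\<dots> = (\<Sum>e\<in>edges G. 2 * of_bool (set_uprod (ends G e) \<subseteq> S)
        + of_bool (\<exists>u\<in>S. \<exists>v\<in>verts G - S. ends G e = Upair u v))"
    by (rule sum.cong[OF refl ends_count])
  also have "\<dots> = 2 * edges_inside G S + edges_between G S (verts G - S)"
    unfolding edges_inside_def edges_between_def card_as_sum sum.distrib sum_distrib_left ..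
  finally show ?thesis .
qed

lemma (in finite_multigraph) vol_verts: "vol G (verts G) = 2 * card (edges G)"
proof -
  have "{e \<in> edges G. set_uprod (ends G e) \<subseteq> verts G} = edges G"
    using ends_in_verts by blast
  then show ?thesis
    using vol_eq_inside_plus_between[of "verts G"]
    by (simp add: edges_inside_def edges_between_def)
qed

lemma edges_between_commute: "edges_between G S T = edges_between G T S"
  unfolding edges_between_def by (rule arg_cong[of _ _ card]) (metis Upair_inject)

lemma (in finite_multigraph) min_degree_mult_card_le_vol:
  assumes "S \<subseteq> verts G"
  shows "min_degree G * card S \<le> vol G S"
proof -
  have "min_degree G \<le> degree G v" if "v \<in> S" for v
    unfolding min_degree_def using finite_verts that assms by (intro Min_le) auto
  then show ?thesis
    using sum_bounded_below[of S "min_degree G" "degree G"] by (simp add: vol_def mult.commute)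
qed

section \<open>The deficit of a modularity score\<close>

lemma sum_partition_on:
  assumes "finite V" "partition_on V \<A>"
  shows "(\<Sum>S\<in>\<A>. sum f S) = sum f V"
proof -
  have "sum f (\<Union>\<A>) = (\<Sum>S\<in>\<A>. sum f S)"
    using assms finite_subset[of _ V] disjointD[OF partition_onD2[OF assms(2)]]
    by (subst sum.Union_disjoint) (auto simp: partition_on_def)
  then show ?thesis
    using partition_onD1[OF assms(2)] by simp
qed

lemma (in finite_multigraph) one_minus_modularity_score:
  assumes part: "partition_on (verts G) \<A>" and "edges G \<noteq> {}"
  shows "1 - modularity_score G \<A> =
    (\<Sum>S\<in>\<A>. edges_between G S (verts G - S) / (2 * card (edges G))
           + (vol G S / (2 * card (edges G)))\<^sup>2)"
proof -
  define m where "m = real (card (edges G))"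
  have m: "m > 0"
    using assms finite_edges by (simp add: m_def card_gt_0_iff)
  have volV: "real (vol G (verts G)) = 2 * m"
    by (simp add: vol_verts m_def)
  have "(\<Sum>S\<in>\<A>. vol G S) = vol G (verts G)"
    unfolding vol_def by (rule sum_partition_on[OF finite_verts part])
  then have "(\<Sum>S\<in>\<A>. real (vol G S)) = 2 * m"
    by (metis of_nat_sum volV)
  then have "1 = (\<Sum>S\<in>\<A>. vol G S / (2 * m))"
    using m by (simp flip: sum_divide_distrib)
  then have "1 - modularity_score G \<A> =
      (\<Sum>S\<in>\<A>. vol G S / (2 * m) - (edges_inside G S / m - (vol G S / (2 * m))\<^sup>2))"
    unfolding modularity_score_def volV by (simp add: sum_subtractf m_def)
  also have "\<dots> = (\<Sum>S\<in>\<A>. edges_between G S (verts G - S) / (2 * m) + (vol G S / (2 * m))\<^sup>2)"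
  proof (rule sum.cong[OF refl])
    fix S assume "S \<in> \<A>"
    then have "S \<subseteq> verts G"
      using partition_onD1[OF part] by blast
    then have "real (vol G S) = 2 * edges_inside G S + edges_between G S (verts G - S)"
      by (simp add: vol_eq_inside_plus_between)
    then have "vol G S / (2 * m) = edges_inside G S / m + edges_between G S (verts G - S) / (2 * m)"
      using m by (simp add: field_simps)
    then show "vol G S / (2 * m) - (edges_inside G S / m - (vol G S / (2 * m))\<^sup>2) =
        edges_between G S (verts G - S) / (2 * m) + (vol G S / (2 * m))\<^sup>2"
      by linarith
  qed
  finally show ?thesis
    by (simp add: m_def)
qed

section \<open>Expansion bounds the modularity\<close>

text \<open>
  The contribution of a part with the fraction \<open>x\<close> of the vertices and of its cuts, where
  \<open>t = hn / 2m\<close>. It increases with \<open>t\<close>, so that \<open>t = 1/2\<close> is the worst case, and there one completes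
  the square. The constant \<open>1/4\<close> is what makes \<open>b (1 - 4b)\<close> nonnegative.
\<close>

lemma large_part_inequality:
  fixes b t x :: real
  assumes "0 \<le> b" "b \<le> 1/4" "1/2 \<le> t" "0 \<le> x" "x \<le> 1"
  shows "b \<le> 4 * b * t * (1 - x) + (t * x)\<^sup>2"
proof -
  have "b * 2 * (1 - x) \<le> b * (4 * t) * (1 - x)"
    using assms by (intro mult_right_mono mult_left_mono) auto
  then have "b * 2 * (1 - x) \<le> 4 * b * t * (1 - x)"
    by (simp only: mult_ac)
  moreover have "(1/2 * x)\<^sup>2 \<le> (t * x)\<^sup>2"
    using assms by (intro power_mono mult_right_mono) auto
  moreover have "b * 2 * (1 - x) + (1/2 * x)\<^sup>2 = b + (x/2 - 2 * b)\<^sup>2 + b * (1 - 4 * b)"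
    by (simp add: power2_eq_square algebra_simps)
  moreover have "0 \<le> b * (1 - 4 * b)"
    using assms by simp
  ultimately show ?thesis
    using zero_le_power2[of "x/2 - 2 * b"] by linarith
qed

text \<open>
  The expansion hypothesis is stated as a family of cut bounds rather than through
  \<^const>\<open>edge_expansion\<close>: this form is vacuous for a graph with one vertex, so that the infinite
  expansion of such a graph needs no separate treatment.
\<close>

lemma (in finite_multigraph) modularity_score_le_expansion:
  fixes b :: real and h :: nat
  assumes part: "partition_on (verts G) \<A>"
    and h: "min_degree G = h" "h \<ge> 1"
    and avg: "avg_degree G \<le> 2 * real h"
    and b: "0 \<le> b" "b \<le> 1/4"
    and expand: "\<And>S. S \<subseteq> verts G \<Longrightarrow> 1 \<le> card S \<Longrightarrow> 2 * card S \<le> card (verts G)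
      \<Longrightarrow> 2 * h * b * card S \<le> edges_between G S (verts G - S)"
  shows "modularity_score G \<A> \<le> 1 - b"
proof -
  define n where "n = real (card (verts G))"
  define m where "m = real (card (edges G))"
  define t where "t = h * n / (2 * m)"
  define cut where "cut S = real (edges_between G S (verts G - S))" for S
  have n: "n > 0"
    using finite_verts verts_nonempty by (simp add: n_def card_gt_0_iff)
  have volV: "real (vol G (verts G)) = 2 * m"
    by (simp add: vol_verts m_def)
  have vol_ge: "real h * card S \<le> vol G S" if "S \<subseteq> verts G" for S
    using min_degree_mult_card_le_vol[OF that] h by (metis of_nat_le_iff of_nat_mult)
  have "0 < h * n"
    using h n by simp
  also have "h * n \<le> 2 * m"
    using vol_ge[of "verts G"] volV by (simp add: n_def)
  finally have m: "m > 0"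
    by simp
  then have edges_nonempty: "edges G \<noteq> {}"
    by (auto simp: m_def)
  have "m \<le> h * n"
    using avg n unfolding avg_degree_def volV n_def[symmetric] by (simp add: field_simps)
  then have t: "1/2 \<le> t"
    using m by (simp add: t_def field_simps)

  have finA: "finite \<A>"
    using part finite_verts by (metis finite_elements)
  have parts: "S \<subseteq> verts G" "finite S" "card S \<ge> 1" if "S \<in> \<A>" for S
  proof -
    show sub: "S \<subseteq> verts G"
      using that partition_onD1[OF part] by blast
    then show "finite S"
      using finite_verts finite_subset by blast
    then show "card S \<ge> 1"
      using that partition_onD3[OF part] by (metis One_nat_def Suc_leI card_gt_0_iff)
  qed
  have "(\<Sum>S\<in>\<A>. card S) = card (verts G)"
    unfolding card_eq_sum by (rule sum_partition_on[OF finite_verts part])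
  then have sum_card: "(\<Sum>S\<in>\<A>. real (card S)) = n"
    by (metis n_def of_nat_sum)

  have deficit: "1 - modularity_score G \<A> = (\<Sum>S\<in>\<A>. cut S) / (2 * m) + (\<Sum>S\<in>\<A>. (vol G S / (2 * m))\<^sup>2)"
    unfolding one_minus_modularity_score[OF part edges_nonempty]
    by (simp add: sum.distrib sum_divide_distrib cut_def m_def)
  have "b \<le> 1 - modularity_score G \<A>"
  proof (cases "\<forall>S\<in>\<A>. 2 * card S \<le> card (verts G)")
    case True
    have "2 * h * b * n = (\<Sum>S\<in>\<A>. 2 * h * b * card S)"
      by (simp add: sum_card flip: sum_distrib_left)
    also have "\<dots> \<le> (\<Sum>S\<in>\<A>. cut S)"
      unfolding cut_def using True parts expand by (intro sum_mono) auto
    finally have "2 * h * b * n / (2 * m) \<le> (\<Sum>S\<in>\<A>. cut S) / (2 * m)"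
      using m by (intro divide_right_mono) auto
    moreover have "2 * h * b * n / (2 * m) = b * (2 * t)"
      by (simp add: t_def)
    moreover have "b * 1 \<le> b * (2 * t)"
      using b t by (intro mult_left_mono) auto
    moreover have "0 \<le> (\<Sum>S\<in>\<A>. (vol G S / (2 * m))\<^sup>2)"
      by (intro sum_nonneg) simp
    ultimately show ?thesis
      unfolding deficit by linarith
  next
    case False
    then obtain B where B: "B \<in> \<A>" "2 * card B > card (verts G)"
      by force
    define x where "x = card B / n"
    have "card B \<le> card (verts G)"
      using parts[OF B(1)] finite_verts card_mono by blast
    then have x: "0 \<le> x" "x \<le> 1"
      using n by (auto simp: x_def n_def)
    have cardB: "real (card B) = n * x"
      using n by (simp add: x_def)
    have card_rest: "(\<Sum>S\<in>\<A> - {B}. real (card S)) = n * (1 - x)"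
      using sum_card sum.remove[OF finA B(1), of "\<lambda>S. real (card S)"] cardB
      by (simp add: algebra_simps)
    have card_compl: "card (verts G - B) = card (verts G) - card B"
      using parts[OF B(1)] by (simp add: card_Diff_subset)

    have "2 * h * b * card (verts G - B) \<le> cut B"
    proof (cases "card (verts G - B) \<ge> 1")
      case True
      have "verts G - (verts G - B) = B"
        using parts[OF B(1)] by blast
      then show ?thesis
        using expand[of "verts G - B"] True B card_compl
        by (auto simp: cut_def edges_between_commute[of G B])
    next
      case False
      then have "card (verts G - B) = 0"
        by linarith
      then show ?thesis
        by (simp add: cut_def)
    qed
    moreover have "real (card (verts G - B)) = n * (1 - x)"
      using \<open>card B \<le> card (verts G)\<close> cardB card_compl by (simp add: n_def algebra_simps of_nat_diff)
    ultimately have cut_B: "2 * h * b * (n * (1 - x)) \<le> cut B"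
      by simp

    have "2 * h * b * card S \<le> cut S" if "S \<in> \<A> - {B}" for S
    proof -
      have "S \<inter> B = {}"
        using disjointD[OF partition_onD2[OF part]] that B(1) by blast
      then have "card S \<le> card (verts G - B)"
        using that parts finite_verts by (intro card_mono) blast+
      then show ?thesis
        unfolding cut_def using that parts[of S] card_compl B(2) by (intro expand) auto
    qed
    then have "2 * h * b * (n * (1 - x)) \<le> (\<Sum>S\<in>\<A> - {B}. cut S)"
      by (subst card_rest[symmetric], subst sum_distrib_left) (rule sum_mono)
    then have "4 * h * b * (n * (1 - x)) \<le> (\<Sum>S\<in>\<A>. cut S)"
      using cut_B by (simp add: sum.remove[OF finA B(1)])
    then have "4 * h * b * (n * (1 - x)) / (2 * m) \<le> (\<Sum>S\<in>\<A>. cut S) / (2 * m)"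
      using m by (intro divide_right_mono) auto
    moreover have "4 * h * b * (n * (1 - x)) / (2 * m) = 4 * b * t * (1 - x)"
      by (simp add: t_def)
    ultimately have cuts: "4 * b * t * (1 - x) \<le> (\<Sum>S\<in>\<A>. cut S) / (2 * m)"
      by linarith

    have "t * x = h * card B / (2 * m)"
      by (simp add: t_def cardB)
    also have "\<dots> \<le> vol G B / (2 * m)"
      using vol_ge[OF parts(1)[OF B(1)]] m by (intro divide_right_mono) auto
    finally have "(t * x)\<^sup>2 \<le> (vol G B / (2 * m))\<^sup>2"
      using t x by (intro power_mono) auto
    also have "\<dots> \<le> (\<Sum>S\<in>\<A>. (vol G S / (2 * m))\<^sup>2)"
      using finA B(1) by (intro member_le_sum) auto
    finally show ?thesis
      using cuts large_part_inequality[OF b t x] unfolding deficit by linarith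
  qed
  then show ?thesis
    by linarith
qed

lemma (in finite_multigraph) modularity_leI:
  assumes "\<And>\<A>. partition_on (verts G) \<A> \<Longrightarrow> modularity_score G \<A> \<le> c"
  shows "modularity G \<le> c"
proof -
  have "{\<A>. partition_on (verts G) \<A>} \<subseteq> Pow (Pow (verts G))"
    by (auto simp: partition_on_def)
  then have "finite {\<A>. partition_on (verts G) \<A>}"
    by (rule finite_subset) (simp add: finite_verts)
  moreover have "partition_on (verts G) {verts G}"
    using verts_nonempty by (simp add: partition_on_space)
  ultimately show ?thesis
    unfolding modularity_def using assms by (intro Max.boundedI) auto
qed

text \<open>
  Capping at \<open>c\<close> turns the expansion into a real number, also in the case of one vertex.
\<close>

lemma (in finite_multigraph) capped_edge_expansion:
  fixes k c :: real
  assumes "k > 0" "c \<ge> 0"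
  obtains b where "min (edge_expansion G / ereal k) (ereal c) = ereal b" "0 \<le> b" "b \<le> c"
    "\<And>S. S \<subseteq> verts G \<Longrightarrow> 1 \<le> card S \<Longrightarrow> 2 * card S \<le> card (verts G)
      \<Longrightarrow> k * b * card S \<le> edges_between G S (verts G - S)"
proof (cases "real (card (verts G)) / 2 < 1")
  case True
  then have "edge_expansion G / ereal k = \<infinity>"
    using assms by (simp add: edge_expansion_def)
  then have "min (edge_expansion G / ereal k) (ereal c) = ereal c"
    by simp
  with True assms show ?thesis
    by (intro that[of c]) auto
next
  case False
  define \<S> where "\<S> = {S. S \<subseteq> verts G \<and> 1 \<le> card S \<and> real (card S) \<le> real (card (verts G)) / 2}"
  define ratio where "ratio S = real (edges_between G S (verts G - S)) / real (card S)" for S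
  define a where "a = Min (ratio ` \<S>)"
  have "{real (edges_between G S (verts G - S)) / real (card S) | S.
      S \<subseteq> verts G \<and> 1 \<le> card S \<and> real (card S) \<le> real (card (verts G)) / 2} = ratio ` \<S>"
    by (auto simp: \<S>_def ratio_def)
  then have alpha: "edge_expansion G = ereal a"
    using False by (simp add: edge_expansion_def a_def)
  have fin: "finite (ratio ` \<S>)"
    using finite_verts by (simp add: \<S>_def)
  obtain v where "v \<in> verts G"
    using verts_nonempty by blast
  then have "{v} \<in> \<S>"
    using False by (simp add: \<S>_def)
  then have a: "0 \<le> a"
    unfolding a_def using fin by (subst Min_ge_iff) (auto simp: ratio_def)
  show ?thesis
  proof (rule that[of "min (a / k) c"])
    show "min (edge_expansion G / ereal k) (ereal c) = ereal (min (a / k) c)"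
      using assms by (simp add: alpha flip: ereal_min)
    show "0 \<le> min (a / k) c" "min (a / k) c \<le> c"
      using a assms by auto
    fix S assume S: "S \<subseteq> verts G" "1 \<le> card S" "2 * card S \<le> card (verts G)"
    then have "a \<le> ratio S"
      unfolding a_def using fin by (intro Min_le) (auto simp: \<S>_def)
    then have "a * card S \<le> edges_between G S (verts G - S)"
      using S by (simp add: ratio_def pos_le_divide_eq)
    moreover have "k * min (a / k) c \<le> k * (a / k)"
      using assms by (intro mult_left_mono) auto
    then have "k * min (a / k) c * card S \<le> a * card S"
      using assms by (intro mult_right_mono) auto
    ultimately show "k * min (a / k) c * card S \<le> edges_between G S (verts G - S)"
      by linarith
  qed
qed

theorem lemma1p7:
  fixes G :: "('v, 'e) multigraph" and h :: nat
  assumes "finite_multigraph G"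
    and "min_degree G = h"
    and "h \<ge> 1"
    and "avg_degree G \<le> 2 * real h"
  shows "ereal (modularity G) \<le> 1 - min (edge_expansion G / ereal (2 * real h)) (ereal (3 / 16))"
proof -
  interpret finite_multigraph G
    by fact
  obtain b where b: "min (edge_expansion G / ereal (2 * real h)) (ereal (3 / 16)) = ereal b"
      "0 \<le> b" "b \<le> 3 / 16"
    and expand: "\<And>S. S \<subseteq> verts G \<Longrightarrow> 1 \<le> card S \<Longrightarrow> 2 * card S \<le> card (verts G)
      \<Longrightarrow> 2 * real h * b * card S \<le> edges_between G S (verts G - S)"
    using capped_edge_expansion[of "2 * real h" "3 / 16"] assms(3) by auto
  have "modularity G \<le> 1 - b"
    using assms b expand by (intro modularity_leI modularity_score_le_expansion) auto
  then show ?thesis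
    unfolding b(1) by (simp add: one_ereal_def)
qed

end
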